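(* For any odd integer $n>1$, $$\sum_{k=0}^{n-1}\frac{(q^{-1};q^2)_k}{(q;q)_k}q^k\equiv(-1)^{(n+1)/2}q^{(n^2-1)/4}-(1+q)[n]\pmod{\Phi_n(q)^2}$$ and $$\sum_{k=0}^{n-1}\frac{(q^{-1};q^2)_k}{(q;q)_k}q^{2k}\equiv(-1)^{(n+1)/2}q^{(n^2+3)/4}-2q[n]\pmod{\Phi_n(q)^2}.$$
   Context: The $q$-Pochhammer symbol is defined by $(x;q)_0=1$ and $(x;q)_k=(1-x)(1-xq)\cdots(1-xq^{k-1})$ for $k\ge1$. The $q$-integer is $[n]=1+q+\cdots+q^{n-1}$. $\Phi_n(q)$ denotes the $n$-th cyclotomic polynomial. For rational functions $A(q),B(q)$ in $q$, $A(q)\equiv B(q)\pmod{\Phi_n(q)^2}$ means that $A(q)-B(q)$ can be written as $P(q)/Q(q)$ with polynomials $P,Q$ such that $\Phi_n(q)^2$ divides $P(q)$ and $Q(q)$ is coprime to $\Phi_n(q)$. *)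

theory Defs
  imports Complex_Main "HOL-Computational_Algebra.Computational_Algebra"
begin

definition primitive_roots :: "nat \<Rightarrow> complex set" where
  "primitive_roots n = {z. z ^ n = 1 \<and> (\<forall>m. 0 < m \<and> m < n \<longrightarrow> z ^ m \<noteq> 1)}"

text \<open>The polynomial with rational coefficients whose complex roots are exactly the primitive
  roots of unity of order \<open>n\<close>, each simple. The description is proper for \<open>n > 0\<close>:
  see \<open>of_rat_cyclotomic\<close> below.\<close>

definition cyclotomic :: "nat \<Rightarrow> rat poly" where
  "cyclotomic n = (THE p. map_poly of_rat p = (\<Prod>z\<in>primitive_roots n. [:- z, 1:]))"

lemma map_poly_of_rat_mult:
  "map_poly of_rat (p * r) = (map_poly of_rat p * map_poly of_rat r :: complex poly)"
  by (rule poly_eqI) (simp add: coeff_map_poly coeff_mult of_rat_sum of_rat_mult)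

lemma map_poly_of_rat_add:
  "map_poly of_rat (p + r) = (map_poly of_rat p + map_poly of_rat r :: complex poly)"
  by (rule poly_eqI) (simp add: coeff_map_poly of_rat_add)

lemma map_poly_of_rat_inj:
  "map_poly (of_rat :: rat \<Rightarrow> complex) p = map_poly of_rat r \<longleftrightarrow> p = r"
  by (metis coeff_map_poly of_rat_0 of_rat_eq_iff poly_eqI)

lemma degree_map_poly_of_rat: "degree (map_poly (of_rat :: rat \<Rightarrow> complex) p) = degree p"
  by (rule degree_map_poly) simp

lemma prod_roots_of_unity:
  assumes "n > 0"
  shows "(\<Prod>z\<in>{z::complex. z ^ n = 1}. [:- z, 1:]) = monom 1 n - 1"
proof (rule ccontr)
  let ?S = "{z::complex. z ^ n = 1}"
  let ?P = "(\<Prod>z\<in>?S. [:- z, 1:])"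
  let ?R = "monom 1 n - 1 :: complex poly"
  assume neq: "?P \<noteq> ?R"
  have fin: "finite ?S" using assms by (intro finite_roots_unity) auto
  have degP: "degree ?P = n"
    by (subst degree_prod_eq_sum_degree) (auto simp: card_roots_unity_eq[OF assms])
  have lcP: "lead_coeff ?P = 1" by (subst lead_coeff_prod) simp
  have small: "coeff (?P - ?R) i = 0" if "i \<ge> n" for i
  proof (cases "i = n")
    case True
    then show ?thesis using lcP degP assms by (simp add: coeff_1)
  next
    case False
    then have "i > n" using that by simp
    then show ?thesis using degP by (simp add: coeff_eq_0 coeff_1)
  qed
  have "degree (?P - ?R) < n"
    by (metis (no_types, lifting) eq_iff_diff_eq_0 leading_coeff_0_iff linorder_not_less neq small)
  moreover have "card ?S \<le> card {x. poly (?P - ?R) x = 0}"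
  proof (rule card_mono)
    show "finite {x. poly (?P - ?R) x = 0}" using neq by (intro poly_roots_finite) simp
    show "?S \<subseteq> {x. poly (?P - ?R) x = 0}"
      using fin by (auto simp: poly_prod poly_monom)
  qed
  moreover have "card {x. poly (?P - ?R) x = 0} \<le> degree (?P - ?R)"
    using neq by (intro card_poly_roots_bound) simp
  ultimately show False using card_roots_unity_eq[OF assms] by linarith
qed

lemma roots_of_unity_Un_primitive_roots:
  assumes "n > 0"
  shows "{z::complex. z ^ n = 1} = (\<Union>d\<in>{d. d dvd n}. primitive_roots d)"
proof (intro equalityI subsetI)
  fix z :: complex assume "z \<in> {z. z ^ n = 1}"
  then have z: "z ^ n = 1" by simp
  define d where "d = (LEAST m. 0 < m \<and> z ^ m = 1)"
  have d: "0 < d \<and> z ^ d = 1"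
    unfolding d_def by (rule LeastI[of _ n]) (use z assms in auto)
  have least: "z ^ m \<noteq> 1" if "0 < m" "m < d" for m
    using not_less_Least[of m "\<lambda>m. 0 < m \<and> z ^ m = 1"] that unfolding d_def by auto
  have "z ^ (n mod d) = 1"
  proof -
    have "z ^ n = (z ^ d) ^ (n div d) * z ^ (n mod d)"
      by (metis mult_div_mod_eq power_add power_mult)
    then show ?thesis using z d by simp
  qed
  then have "n mod d = 0" using least[of "n mod d"] d by fastforce
  then show "z \<in> (\<Union>d\<in>{d. d dvd n}. primitive_roots d)"
    using d least by (auto simp: primitive_roots_def)
next
  fix z assume "z \<in> (\<Union>d\<in>{d. d dvd n}. primitive_roots d)"
  then show "z \<in> {z. z ^ n = 1}"
    by (auto simp: primitive_roots_def power_mult elim!: dvdE)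
qed

lemma finite_primitive_roots: "n > 0 \<Longrightarrow> finite (primitive_roots n)"
  by (rule finite_subset[of _ "{z. z ^ n = 1}"])
     (auto simp: primitive_roots_def intro!: finite_roots_unity)

lemma prod_primitive_roots:
  assumes "n > 0"
  shows "(\<Prod>d\<in>{d. d dvd n}. \<Prod>z\<in>primitive_roots d. [:- z, 1:]) = monom 1 n - 1"
proof -
  have "(\<Prod>z\<in>(\<Union>d\<in>{d. d dvd n}. primitive_roots d). [:- z, 1:])
      = (\<Prod>d\<in>{d. d dvd n}. \<Prod>z\<in>primitive_roots d. [:- z, 1:])"
  proof (rule prod.UNION_disjoint)
    show "finite {d. d dvd n}" using assms by simp
    show "\<forall>i\<in>{d. d dvd n}. finite (primitive_roots i)"
      using assms by (auto intro!: finite_primitive_roots dvd_pos_nat[of n])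
    show "\<forall>i\<in>{d. d dvd n}. \<forall>j\<in>{d. d dvd n}.
        i \<noteq> j \<longrightarrow> primitive_roots i \<inter> primitive_roots j = {}"
    proof (intro ballI impI)
      fix i j assume ij: "i \<in> {d. d dvd n}" "j \<in> {d. d dvd n}" "i \<noteq> j"
      then have "0 < i" "0 < j" using assms by (auto intro: dvd_pos_nat[of n])
      then show "primitive_roots i \<inter> primitive_roots j = {}"
        using ij(3) by (auto simp: primitive_roots_def) (metis linorder_neqE_nat)
    qed
  qed
  then show ?thesis
    using prod_roots_of_unity[OF assms] roots_of_unity_Un_primitive_roots[OF assms] by simp
qed

lemma ex_cyclotomic:
  assumes "n > 0"
  shows "\<exists>p. map_poly of_rat p = (\<Prod>z\<in>primitive_roots n. [:- z, 1:])"
  using assms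
proof (induction n rule: less_induct)
  case (less n)
  let ?C = "\<lambda>n. (\<Prod>z\<in>primitive_roots n. [:- z, 1:])"
  define D where "D = {d. d dvd n \<and> d \<noteq> n}"
  have D: "finite D" "{d. d dvd n} = insert n D" "n \<notin> D"
    using less.prems by (auto simp: D_def)
  have "\<exists>f. \<forall>d\<in>D. map_poly of_rat (f d) = ?C d"
  proof (rule bchoice, rule ballI)
    fix d assume "d \<in> D"
    then have "d < n" "0 < d"
      using less.prems by (auto simp: D_def dest: dvd_imp_le intro: dvd_pos_nat[of n] le_neq_implies_less)
    then show "\<exists>p. map_poly of_rat p = ?C d" by (rule less.IH)
  qed
  then obtain f where f: "map_poly of_rat (f d) = ?C d" if "d \<in> D" for d by blast
  define g where "g = prod f D"
  have g: "map_poly of_rat g = prod ?C D"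
  proof -
    have "map_poly of_rat (prod f E) = prod ?C E" if "E \<subseteq> D" for E
      using finite_subset[OF that D(1)] that
      by (induction E rule: finite_induct) (auto simp: map_poly_of_rat_mult f)
    then show ?thesis by (simp add: g_def)
  qed
  have g0: "map_poly of_rat g \<noteq> (0 :: complex poly)"
  proof -
    have "?C d \<noteq> 0" if "d \<in> D" for d
      using that less.prems
      by (subst prod_zero_iff) (auto simp: D_def intro!: finite_primitive_roots dvd_pos_nat[of n])
    then show ?thesis unfolding g using D(1) by (simp add: prod_zero_iff)
  qed
  define x where "x = (monom 1 n - 1 :: rat poly)"
  have x: "map_poly of_rat x = (monom 1 n - 1 :: complex poly)"
    by (rule poly_eqI) (auto simp: x_def coeff_map_poly coeff_1)
  have "?C n * map_poly of_rat g = map_poly of_rat x"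
    using prod_primitive_roots[OF less.prems] D g x by simp
  also have "x = x div g * g + x mod g" by simp
  also have "map_poly of_rat (x div g * g + x mod g) =
      (map_poly of_rat (x div g) * map_poly of_rat g + map_poly of_rat (x mod g) :: complex poly)"
    by (simp only: map_poly_of_rat_mult map_poly_of_rat_add)
  finally have eq: "(?C n - map_poly of_rat (x div g)) * map_poly of_rat g
      = map_poly of_rat (x mod g)"
    by (simp add: algebra_simps)
  have "?C n - map_poly of_rat (x div g) = 0"
  proof (rule ccontr)
    assume a: "?C n - map_poly of_rat (x div g) \<noteq> 0"
    then have "degree (map_poly of_rat (x mod g) :: complex poly)
        = degree (?C n - map_poly of_rat (x div g)) + degree (map_poly of_rat g :: complex poly)"
      using g0 by (simp add: eq[symmetric] degree_mult_eq)
    moreover have "x mod g \<noteq> 0" using a g0 eq by auto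
    moreover have "g \<noteq> 0" using g0 by auto
    ultimately show False
      using degree_mod_less[of g x] by (simp add: degree_map_poly_of_rat)
  qed
  then show ?case by (intro exI[of _ "x div g"]) simp
qed

lemma of_rat_cyclotomic:
  assumes "n > 0"
  shows "map_poly of_rat (cyclotomic n) = (\<Prod>z\<in>primitive_roots n. [:- z, 1:])"
  unfolding cyclotomic_def
  by (rule theI') (metis ex_cyclotomic[OF assms] map_poly_of_rat_inj)

definition qvar :: "rat poly fract" where
  "qvar = Fract [:0, 1:] 1"

definition qpoch :: "'a :: comm_ring_1 \<Rightarrow> 'a \<Rightarrow> nat \<Rightarrow> 'a" where
  "qpoch x q k = (\<Prod>i<k. 1 - x * q ^ i)"

definition qint :: "'a :: comm_ring_1 \<Rightarrow> nat \<Rightarrow> 'a" where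
  "qint q n = (\<Sum>i<n. q ^ i)"

text \<open>The condition \<open>Q \<noteq> 0\<close> is needed for \<open>Fract P Q\<close> to be the quotient
  of \<open>P\<close> by \<open>Q\<close>, since \<open>Fract P 0 = 0\<close>.\<close>

definition cong_cyclotomic_sq :: "nat \<Rightarrow> rat poly fract \<Rightarrow> rat poly fract \<Rightarrow> bool" where
  "cong_cyclotomic_sq n A B \<longleftrightarrow>
     (\<exists>P Q. Q \<noteq> 0 \<and> A - B = Fract P Q \<and> cyclotomic n ^ 2 dvd P \<and> coprime Q (cyclotomic n))"

end

theory Submission
  imports Defs "HOL-Computational_Algebra.Field_as_Ring"
begin

text \<open>Replace the leading parameter \<open>1/q\<close> by \<open>y/q\<close> with \<open>y = q^(-n)\<close>: the sum then terminates
  and is evaluated by the limiting case \<open>c = 0\<close> of the \<open>q\<close>-Chu-Vandermonde formula. Since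
  \<open>1 - y\<close> is divisible by \<open>1 - q^n\<close>, the error made is needed only modulo the first power of the
  cyclotomic polynomial, where it is the derivative at \<open>1\<close> of a polynomial whose values at all
  \<open>n\<close>-th roots of unity are known from the same formula. The second sum reduces to the first one
  by telescoping.\<close>

section \<open>Elementary identities for q-Pochhammer symbols and q-integers\<close>

lemma qpoch_0 [simp]: "qpoch x q 0 = 1"
  by (simp add: qpoch_def)

lemma qpoch_Suc: "qpoch x q (Suc k) = qpoch x q k * (1 - x * q ^ k)"
  by (simp add: qpoch_def)

lemma qpoch_Suc_left: "qpoch x q (Suc k) = (1 - x) * qpoch (x * q) q k"
  by (simp add: qpoch_def prod.lessThan_Suc_shift mult.assoc del: prod.lessThan_Suc)

lemma qpoch_self_nonzero:
  fixes q :: "'a :: idom"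
  assumes "\<And>j. 0 < j \<Longrightarrow> j \<le> k \<Longrightarrow> q ^ j \<noteq> 1"
  shows "qpoch q q k \<noteq> 0"
  using assms[of "Suc _"] by (auto simp: qpoch_def)

lemma qint_mult: "(1 - q) * qint q n = 1 - q ^ n"
  by (simp add: qint_def one_diff_power_eq)

section \<open>The sum as a function of its leading parameter\<close>

text \<open>Writing \<open>c = a^2\<close> splits each factor \<open>1 - c q^(2i)\<close> into
  \<open>(1 - a q^i)(1 + a q^i)\<close>, so this is the series 2phi1(a, -a; 0; q, q) truncated after
  the index \<open>K\<close>.\<close>

definition qsum :: "'a :: field \<Rightarrow> nat \<Rightarrow> 'a \<Rightarrow> 'a" where
  "qsum q K c = (\<Sum>k\<le>K. qpoch c (q ^ 2) k / qpoch q q k * q ^ k)"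

text \<open>The symbols for \<open>c\<close> and \<open>c q^2\<close> differ only in their end
  factors, \<open>(c;q^2)_(k+1) = (1 - c)(c q^2;q^2)_k\<close>. With the weight \<open>c q\<close>
  the combined summands telescope, which makes induction on \<open>K\<close> possible for every
  \<open>c\<close>.\<close>

lemma qsum_contiguous:
  fixes q :: "'a :: field"
  assumes "\<And>j. 0 < j \<Longrightarrow> j \<le> K \<Longrightarrow> q ^ j \<noteq> 1"
  shows "qsum q K c + c * q * qsum q K (c * q ^ 2) =
    qpoch (c * q ^ 2) (q ^ 2) K * (1 + c * q ^ Suc K) / qpoch q q K"
  using assms
proof (induction K)
  case 0
  then show ?case by (simp add: qsum_def)
next
  case (Suc K)
  let ?A = "qpoch (c * q ^ 2) (q ^ 2) K" and ?B = "qpoch q q K"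
  have B: "?B \<noteq> 0" and r: "1 - q ^ Suc K \<noteq> 0"
    using Suc.prems by (auto intro!: qpoch_self_nonzero simp del: power_Suc)
  have p: "(q ^ 2) ^ K = q ^ K * q ^ K" by (simp add: power_add[symmetric] power_mult[symmetric] mult_2)
  have "qsum q (Suc K) c + c * q * qsum q (Suc K) (c * q ^ 2)
      = (qsum q K c + c * q * qsum q K (c * q ^ 2))
        + (qpoch c (q ^ 2) (Suc K) + c * q * qpoch (c * q ^ 2) (q ^ 2) (Suc K)) /
          qpoch q q (Suc K) * q ^ Suc K"
    by (simp add: qsum_def algebra_simps add_divide_distrib)
  also have "\<dots> = ?A * (1 + c * q ^ Suc K) / ?B
        + ((1 - c) * ?A + c * q * (?A * (1 - c * q ^ 2 * (q ^ 2) ^ K))) / (?B * (1 - q ^ Suc K)) * q ^ Suc K"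
    using Suc by (simp add: qpoch_Suc_left[of c] qpoch_Suc[of "c * q ^ 2"] qpoch_Suc[of q])
  also have "\<dots> = ?A * ((1 - q ^ Suc K) * (1 + c * q ^ Suc K)
        + (1 - c + c * q * (1 - c * q ^ 2 * (q ^ 2) ^ K)) * q ^ Suc K) / (?B * (1 - q ^ Suc K))"
    using B r by (simp add: field_simps del: power_Suc)
  \<comment> \<open>With \<open>r = q^(K+1)\<close> the left side expands to
    \<open>(1 - c r^2) + c q r (1 - c r^2)\<close>.\<close>
  also have "(1 - q ^ Suc K) * (1 + c * q ^ Suc K)
        + (1 - c + c * q * (1 - c * q ^ 2 * (q ^ 2) ^ K)) * q ^ Suc K
      = (1 - c * q ^ 2 * (q ^ 2) ^ K) * (1 + c * q ^ Suc (Suc K))"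
    unfolding p by (simp add: algebra_simps power2_eq_square)
  finally show ?case by (simp add: qpoch_Suc mult.assoc)
qed

text \<open>At \<open>c = q^(-2(M+1))\<close> the right side of the contiguous relation vanishes.
  What remains is a two-term recursion with factor \<open>-q^(-(2M+1))\<close>, and the odd numbers
  below \<open>2M\<close> add up to \<open>M^2\<close>.\<close>

lemma qsum_terminating:
  fixes q :: "'a :: field"
  assumes "\<And>j. 0 < j \<Longrightarrow> j \<le> K \<Longrightarrow> q ^ j \<noteq> 1" and q: "q \<noteq> 0" and "M \<le> K"
  shows "qsum q K (inverse q ^ (2 * M)) = (- 1) ^ M * inverse q ^ M\<^sup>2"
  using \<open>M \<le> K\<close>
proof (induction M)
  case 0
  have "qpoch 1 (q ^ 2) k = 0" if "k \<noteq> 0" for k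
    using that by (cases k) (auto simp: qpoch_Suc_left)
  then have "qsum q K 1 = (\<Sum>k\<in>{0}. qpoch 1 (q ^ 2) k / qpoch q q k * q ^ k)"
    unfolding qsum_def by (intro sum.mono_neutral_right) auto
  then show ?case by simp
next
  case (Suc M)
  let ?c = "inverse q ^ (2 * Suc M)"
  have c: "?c * q ^ 2 = inverse q ^ (2 * M)"
    using q by (simp add: field_simps power2_eq_square)
  have "qpoch (inverse q ^ (2 * M)) (q ^ 2) K = 0"
    unfolding qpoch_def using Suc.prems q
    \<comment> \<open>The vanishing factor has index \<open>M\<close>, which is in range because
      \<open>Suc M \<le> K\<close>.\<close>
    by (intro prod_zero bexI[of _ M]) (auto simp: power_mult[symmetric] field_simps)
  then have "qsum q K ?c = - (?c * q * qsum q K (inverse q ^ (2 * M)))"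
    using qsum_contiguous[OF assms(1), of K ?c] unfolding c by (simp add: eq_neg_iff_add_eq_0)
  also have "\<dots> = (- 1) ^ Suc M * inverse q ^ (Suc M)\<^sup>2"
    using Suc q by (simp add: power2_eq_square field_simps power_add mult_2_right)
  finally show ?case .
qed

text \<open>The second sum in the contiguous relation drops out at \<open>c = 0\<close>. This value
  later serves as the constant coefficient of an interpolated polynomial.\<close>

lemma qsum_0:
  fixes q :: "'a :: field"
  assumes "\<And>j. 0 < j \<Longrightarrow> j \<le> K \<Longrightarrow> q ^ j \<noteq> 1"
  shows "qsum q K 0 = 1 / qpoch q q K"
  using qsum_contiguous[OF assms, of K 0] by (simp add: qpoch_def)

text \<open>With \<open>F_k = (c;q^2)_(k+1) / (q;q)_k\<close> one has
  \<open>F_k - F_(k-1) = (c;q^2)_k (q^k - c q^(2k)) / (q;q)_k\<close>, so the difference of the two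
  weighted sums telescopes to \<open>F_K\<close>.\<close>

lemma qsum_square_weight:
  fixes q :: "'a :: field"
  assumes "\<And>j. 0 < j \<Longrightarrow> j \<le> K \<Longrightarrow> q ^ j \<noteq> 1"
  shows "qsum q K c = c * (\<Sum>k\<le>K. qpoch c (q ^ 2) k / qpoch q q k * q ^ (2 * k))
    + qpoch c (q ^ 2) (Suc K) / qpoch q q K"
  using assms
proof (induction K)
  case 0
  then show ?case by (simp add: qsum_def qpoch_Suc)
next
  case (Suc K)
  let ?B = "qpoch q q K" and ?C = "qpoch c (q ^ 2) (Suc K)" and ?r = "q ^ Suc K"
  have B: "?B \<noteq> 0" and r: "1 - ?r \<noteq> 0"
    using Suc.prems by (auto intro!: qpoch_self_nonzero simp del: power_Suc)
  have p: "q ^ (2 * Suc K) = ?r * ?r" "(q ^ 2) ^ Suc K = ?r * ?r"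
    by (simp_all only: power_add[symmetric] power_mult[symmetric] mult_2)
  have B': "qpoch q q (Suc K) = ?B * (1 - ?r)" by (simp add: qpoch_Suc)
  have "?C / ?B + ?C / (?B * (1 - ?r)) * ?r =
      c * (?C / (?B * (1 - ?r)) * (?r * ?r)) + ?C * (1 - c * (?r * ?r)) / (?B * (1 - ?r))"
  proof -
    have "?C / ?B = ?C * (1 - ?r) / (?B * (1 - ?r))" using r by simp
    then show ?thesis
      by (simp add: add_divide_distrib[symmetric] algebra_simps del: power_Suc)
  qed
  then show ?case
    using Suc unfolding qsum_def sum.atMost_Suc p B' qpoch_Suc[of c _ "Suc K"]
    by (simp add: distrib_left del: power_Suc)
qed

section \<open>Difference quotient and derivative in the leading parameter\<close>

primrec qpoch_quot :: "'a :: comm_ring_1 \<Rightarrow> 'a \<Rightarrow> 'a \<Rightarrow> nat \<Rightarrow> 'a" where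
  "qpoch_quot y c p 0 = 0"
| "qpoch_quot y c p (Suc k) = qpoch_quot y c p k * (1 - y * c * p ^ k) - qpoch c p k * (c * p ^ k)"

text \<open>Splitting off \<open>1 - y\<close> by a recursion instead of a division keeps the
  quotient meaningful at \<open>y = 1\<close>, the value that \<open>y = q^(-n)\<close> takes at an
  \<open>n\<close>-th root of unity.\<close>

lemma qpoch_diff: "qpoch c p k - qpoch (y * c) p k = (1 - y) * qpoch_quot y c p k"
proof (induction k)
  case (Suc k)
  have "qpoch c p (Suc k) - qpoch (y * c) p (Suc k)
     = (qpoch c p k - qpoch (y * c) p k) * (1 - y * c * p ^ k) - (1 - y) * qpoch c p k * (c * p ^ k)"
    by (simp add: qpoch_Suc algebra_simps)
  then show ?case unfolding Suc by (simp add: algebra_simps)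
qed simp

definition qpoch_poly :: "'a :: field \<Rightarrow> 'a \<Rightarrow> nat \<Rightarrow> 'a poly" where
  "qpoch_poly c p k = (\<Prod>i<k. [:1, - (c * p ^ i):])"

lemma poly_qpoch_poly: "poly (qpoch_poly c p k) x = qpoch (x * c) p k"
  by (simp add: qpoch_poly_def qpoch_def poly_prod mult.assoc)

lemma degree_qpoch_poly_le: "degree (qpoch_poly c p k) \<le> k"
  unfolding qpoch_poly_def
  by (rule order.trans[OF degree_prod_sum_le]) (auto intro: order.trans[OF sum_bounded_above[of _ _ 1]])

text \<open>At \<open>y = 1\<close> the recursion of the difference quotient is the product
  rule.\<close>

lemma poly_pderiv_qpoch_poly: "poly (pderiv (qpoch_poly c p k)) 1 = qpoch_quot 1 c p k"
proof (induction k)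
  case (Suc k)
  have "qpoch_poly c p (Suc k) = qpoch_poly c p k * [:1, - (c * p ^ k):]"
    by (simp add: qpoch_poly_def)
  then show ?case
    using Suc by (simp add: pderiv_mult poly_qpoch_poly pderiv_pCons algebra_simps del: mult_pCons_right)
qed (simp add: qpoch_poly_def)

section \<open>Sums and products over the complex roots of unity\<close>

lemma primitive_root_power_eq_1_iff:
  assumes "z \<in> primitive_roots n" "n > 0"
  shows "z ^ k = 1 \<longleftrightarrow> n dvd k"
proof
  assume k: "z ^ k = 1"
  have "z ^ k = (z ^ n) ^ (k div n) * z ^ (k mod n)"
    by (metis mult_div_mod_eq power_add power_mult)
  then have "z ^ (k mod n) = 1" using k assms by (simp add: primitive_roots_def)
  then have "k mod n = 0"
    using assms mod_less_divisor[of n k] unfolding primitive_roots_def by auto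
  then show "n dvd k" by auto
qed (use assms in \<open>auto simp: primitive_roots_def power_mult elim!: dvdE\<close>)

lemma primitive_root_power:
  assumes "z \<in> primitive_roots n" "n > 0" "coprime a n"
  shows "z ^ a \<in> primitive_roots n"
proof -
  have *: "(z ^ a) ^ m = 1 \<longleftrightarrow> n dvd m" for m
    using assms primitive_root_power_eq_1_iff[OF assms(1,2), of "a * m"]
    by (simp add: power_mult[symmetric] coprime_dvd_mult_right_iff coprime_commute)
  show ?thesis unfolding primitive_roots_def using * by (auto dest: dvd_imp_le)
qed

lemma primitive_root_inverse:
  "z \<in> primitive_roots n \<Longrightarrow> inverse z \<in> primitive_roots n"
  by (simp add: primitive_roots_def power_inverse)

lemma primitive_root_nonzero: "z \<in> primitive_roots n \<Longrightarrow> n > 0 \<Longrightarrow> z \<noteq> 0"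
  by (auto simp: primitive_roots_def zero_power)

lemma bij_betw_primitive_root_powers:
  assumes z: "z \<in> primitive_roots n" "n > 0"
  shows "bij_betw (\<lambda>i. z ^ i) {..<n} {w. w ^ n = 1}"
proof -
  have z0: "z \<noteq> 0" using z by (rule primitive_root_nonzero)
  have le: "i = j" if "z ^ i = z ^ j" "i \<le> j" "j < n" for i j
  proof -
    have "z ^ j = z ^ i * z ^ (j - i)" using that by (metis le_add_diff_inverse power_add)
    then have "z ^ (j - i) = 1" using that z0 by simp
    then have "n dvd j - i" using primitive_root_power_eq_1_iff[OF z] by blast
    then have "j - i = 0" using that by (meson less_imp_diff_less nat_dvd_not_less neq0_conv)
    then show ?thesis using that by simp
  qed
  have inj: "inj_on (\<lambda>i. z ^ i) {..<n}"
  proof (rule inj_onI)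
    fix i j assume "i \<in> {..<n}" "j \<in> {..<n}" "z ^ i = z ^ j"
    then show "i = j" using le[of i j] le[of j i] by (cases "i \<le> j") auto
  qed
  have zn: "z ^ n = 1" using z by (simp add: primitive_roots_def)
  have "(z ^ i) ^ n = 1" for i
    using zn by (metis mult.commute power_mult power_one)
  then have sub: "(\<lambda>i. z ^ i) ` {..<n} \<subseteq> {w. w ^ n = 1}" by auto
  have "(\<lambda>i. z ^ i) ` {..<n} = {w. w ^ n = 1}"
    by (rule card_subset_eq[OF _ sub])
       (use z inj in \<open>auto simp: card_image card_roots_unity_eq intro!: finite_roots_unity\<close>)
  then show ?thesis using inj by (simp add: bij_betw_def)
qed

lemma sum_roots_unity_power:
  assumes z: "z \<in> primitive_roots n" and j: "0 < j" "j < n"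
  shows "(\<Sum>w | w ^ n = 1. w ^ j) = (0 :: complex)"
proof -
  have n: "n > 0" using j by simp
  have ne: "z ^ j \<noteq> 1" using primitive_root_power_eq_1_iff[OF z n, of j] j by (auto dest: dvd_imp_le)
  have zn: "z ^ n = 1" using z by (simp add: primitive_roots_def)
  have "(\<Sum>w | w ^ n = 1. w ^ j) = (\<Sum>i<n. (z ^ i) ^ j)"
    using sum.reindex_bij_betw[OF bij_betw_primitive_root_powers[OF z n], of "\<lambda>w. w ^ j"] by simp
  also have "\<dots> = (\<Sum>i<n. (z ^ j) ^ i)" by (simp add: power_mult[symmetric] mult.commute)
  also have "(1 - z ^ j) * \<dots> = 1 - (z ^ n) ^ j"
    by (metis one_diff_power_eq power_mult mult.commute)
  then have "(\<Sum>i<n. (z ^ j) ^ i) = 0" using ne zn by simp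
  finally show ?thesis .
qed

text \<open>Cancelling \<open>X - 1\<close> from \<open>X^n - 1\<close> leaves
  \<open>1 + X + ... + X^(n-1)\<close>, to be evaluated at 1.\<close>

lemma prod_roots_unity_minus_1:
  assumes n: "n > 0"
  shows "(\<Prod>w\<in>{w. w ^ n = 1} - {1}. 1 - w) = (of_nat n :: complex)"
proof -
  let ?U = "{w :: complex. w ^ n = 1}"
  have fin: "finite ?U" using n by (intro finite_roots_unity) auto
  have "[:- 1, 1:] * (\<Prod>w\<in>?U - {1}. [:- w, 1:]) = monom 1 n - 1"
    using prod_roots_of_unity[OF n] prod.remove[OF fin, of 1 "\<lambda>w. [:- w, 1:]"] by simp
  also have "\<dots> = [:- 1, 1:] * (\<Sum>i<n. monom 1 i)"
  proof -
    have X: "[:0, 1:] ^ i = (monom 1 i :: complex poly)" for i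
      by (simp add: monom_altdef)
    have "[:0, 1:] - 1 = ([:- 1, 1:] :: complex poly)" by (simp add: one_pCons)
    then show ?thesis using power_diff_1_eq[of "[:0, 1:] :: complex poly" n] by (simp add: X)
  qed
  finally have "(\<Prod>w\<in>?U - {1}. [:- w, 1:]) = (\<Sum>i<n. monom 1 i)"
    by (metis mult_left_cancel pCons_eq_0_iff zero_neq_one)
  then have "poly (\<Prod>w\<in>?U - {1}. [:- w, 1:]) 1 = of_nat n"
    by (simp add: poly_sum poly_monom)
  then show ?thesis by (simp add: poly_prod)
qed

lemma inverse_over_one_minus_inverse:
  fixes w :: "'a :: field"
  assumes "w \<noteq> 0"
  shows "inverse w / (1 - inverse w) = - (1 / (1 - w))"
proof -
  have "inverse w / (1 - inverse w) = (w * inverse w) / (w * (1 - inverse w))"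
    using assms by (simp only: mult_divide_mult_cancel_left not_False_eq_True)
  also have "\<dots> = 1 / (w - 1)" using assms by (simp add: right_diff_distrib)
  also have "\<dots> = - (1 / (1 - w))" by (metis minus_diff_eq minus_divide_right)
  finally show ?thesis .
qed

lemma sum_inverse_roots_unity:
  "(\<Sum>w\<in>{w. w ^ n = 1} - {1}. f (inverse w)) = (\<Sum>w\<in>{w :: complex. w ^ n = 1} - {1}. f w)"
  by (rule sum.reindex_bij_witness[of _ inverse inverse]) (auto simp: power_inverse)

text \<open>For \<open>j = 0\<close>, pairing \<open>w\<close> with \<open>1/w\<close> gives
  \<open>-1\<close> per pair of summands. Raising \<open>j\<close> by one subtracts the sum of
  \<open>w^(j+1)\<close> over \<open>w \<noteq> 1\<close>, which is \<open>-1\<close> as long as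
  \<open>j + 1 < n\<close>.\<close>

lemma sum_roots_unity_pole:
  assumes z: "z \<in> primitive_roots n" and j: "j < n"
  shows "(\<Sum>w\<in>{w :: complex. w ^ n = 1} - {1}. w ^ j * (w / (1 - w))) = of_nat j - (of_nat n - 1) / 2"
  using j
proof (induction j)
  case 0
  let ?U = "{w :: complex. w ^ n = 1} - {1}"
  let ?S = "\<Sum>w\<in>?U. w / (1 - w)"
  have n: "n > 0" using 0 by simp
  have "?S + ?S = (\<Sum>w\<in>?U. w / (1 - w) + inverse w / (1 - inverse w))"
    using sum_inverse_roots_unity[where n = n and f = "\<lambda>w. w / (1 - w)"] by (simp add: sum.distrib)
  also have "\<dots> = (\<Sum>w\<in>?U. - 1)"
  proof (rule sum.cong[OF refl])
    fix w assume w: "w \<in> ?U"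
    then have "w \<noteq> 0" "1 - w \<noteq> 0" using n by (auto simp: zero_power)
    then show "w / (1 - w) + inverse w / (1 - inverse w) = - 1"
      by (simp add: inverse_over_one_minus_inverse diff_divide_distrib[symmetric] nonzero_divide_eq_eq)
  qed
  also have "\<dots> = - (of_nat n - 1)"
    using n card_roots_unity_eq[of n] by (simp add: card_Diff_singleton of_nat_diff)
  finally have "2 * ?S = - (of_nat n - 1)" by simp
  then show ?case by (simp add: field_simps)
next
  case (Suc j)
  let ?U = "{w :: complex. w ^ n = 1}"
  have fin: "finite ?U" using Suc.prems by (intro finite_roots_unity) auto
  have "(\<Sum>w\<in>?U - {1}. w ^ Suc j) = - 1"
    using sum_roots_unity_power[OF z, of "Suc j"] Suc.prems sum.remove[OF fin, of 1 "\<lambda>w. w ^ Suc j"]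
    by (simp add: eq_neg_iff_add_eq_0 add.commute)
  moreover have "(\<Sum>w\<in>?U - {1}. w ^ Suc j * (w / (1 - w))) =
      (\<Sum>w\<in>?U - {1}. w ^ j * (w / (1 - w)) - w ^ Suc j)"
    by (rule sum.cong) (auto simp: field_simps)
  ultimately show ?case using Suc by (simp add: sum_subtractf del: power_Suc)
qed

text \<open>Both sides are linear in \<open>g\<close>, so the monomials \<open>x^j\<close> with
  \<open>j < n\<close> suffice: each contributes \<open>j - (n-1)/2\<close>, and the weights
  \<open>j\<close> and 1 produce \<open>g'(1)\<close> and \<open>g(1)\<close>.\<close>

lemma pderiv_at_1_via_roots_unity:
  assumes z: "z \<in> primitive_roots n" and g: "degree g < n"
  shows "(\<Sum>w\<in>{w :: complex. w ^ n = 1} - {1}. poly g w * (w / (1 - w))) =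
    poly (pderiv g) 1 - (of_nat n - 1) / 2 * poly g 1"
proof -
  let ?U = "{w :: complex. w ^ n = 1} - {1}"
  have "(\<Sum>w\<in>?U. poly g w * (w / (1 - w))) =
      (\<Sum>w\<in>?U. \<Sum>j\<le>degree g. coeff g j * (w ^ j * (w / (1 - w))))"
    by (simp only: poly_altdef sum_distrib_right mult.assoc)
  also have "\<dots> = (\<Sum>j\<le>degree g. coeff g j * (\<Sum>w\<in>?U. w ^ j * (w / (1 - w))))"
    by (subst sum.swap) (simp add: sum_distrib_left)
  also have "\<dots> = (\<Sum>j\<le>degree g. coeff g j * (of_nat j - (of_nat n - 1) / 2))"
    using g by (intro sum.cong refl arg_cong2[where f = "(*)"] sum_roots_unity_pole[OF z]) auto
  also have "\<dots> = (\<Sum>j\<le>degree g. of_nat j * coeff g j) - (of_nat n - 1) / 2 * poly g 1"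
    by (simp only: right_diff_distrib sum_subtractf) (simp add: poly_altdef sum_distrib_left mult_ac)
  also have "(\<Sum>j\<le>degree g. of_nat j * coeff g j) = poly (pderiv g) 1"
  proof (cases "degree g")
    case 0
    then have "pderiv g = 0" by (simp add: pderiv_eq_0_iff)
    then show ?thesis using 0 by simp
  next
    case (Suc d)
    then show ?thesis
      by (simp only: sum.atMost_Suc_shift)
         (simp add: poly_altdef degree_pderiv coeff_pderiv)
  qed
  finally show ?thesis .
qed

lemma sum_poly_roots_unity:
  assumes z: "z \<in> primitive_roots n" and g: "degree g < n"
  shows "(\<Sum>w | w ^ n = 1. poly g w) = (of_nat n :: complex) * poly g 0"
proof -
  let ?U = "{w :: complex. w ^ n = 1}"
  have n: "n > 0" using g by simp
  have "(\<Sum>w\<in>?U. poly g w) = (\<Sum>j\<le>degree g. coeff g j * (\<Sum>w\<in>?U. w ^ j))"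
    by (simp add: poly_altdef sum.swap[of _ ?U] sum_distrib_left)
  also have "\<dots> = (\<Sum>j\<in>{0}. coeff g j * (\<Sum>w\<in>?U. w ^ j))"
    by (rule sum.mono_neutral_right) (use g in \<open>auto simp: sum_roots_unity_power[OF z]\<close>)
  finally show ?thesis using n by (simp add: card_roots_unity_eq poly_0_coeff_0)
qed


section \<open>Evaluation of the error term at primitive roots of unity\<close>

lemma prod_one_minus_primitive_root_powers:
  assumes p: "p \<in> primitive_roots n" and c: "c ^ n = 1" and N: "N < n" "c * p ^ N = 1"
  shows "(\<Prod>i\<in>{..<n} - {N}. 1 - c * p ^ i) = (of_nat n :: complex)"
proof -
  let ?U = "{w :: complex. w ^ n = 1}"
  have n: "n > 0" and c0: "c \<noteq> 0" using N by auto
  have "bij_betw (\<lambda>w. c * w) ?U ?U"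
    by (rule bij_betw_byWitness[of _ "\<lambda>w. inverse c * w"])
       (use c c0 in \<open>auto simp: power_mult_distrib power_inverse\<close>)
  \<comment> \<open>The numbers \<open>c p^i\<close> run through all \<open>n\<close>-th roots of
    unity, and index \<open>N\<close> is the one that hits 1.\<close>
  then have "bij_betw (\<lambda>i. c * p ^ i) {..<n} ?U"
    using bij_betw_trans[OF bij_betw_primitive_root_powers[OF p n]] by (simp add: o_def)
  then have "bij_betw (\<lambda>i. c * p ^ i) ({..<n} - {N}) (?U - {1})"
    using bij_betw_DiffI[of _ "{..<n}" ?U "{N}" "{1}"] N by (auto simp: bij_betw_def)
  then show ?thesis
    using prod.reindex_bij_betw[of _ _ _ "\<lambda>w. 1 - w"] prod_roots_unity_minus_1[OF n] by metis
qed

lemma qpoch_primitive_root: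
  assumes "z \<in> primitive_roots n" "n > 0"
  shows "qpoch z z (n - 1) = of_nat n"
proof -
  have "{..<n} - {n - 1} = {..<n - 1}" using assms by auto
  moreover have "z ^ n = 1" "z * z ^ (n - 1) = 1"
    using assms power_minus_mult[of n z] by (simp_all add: primitive_roots_def mult.commute)
  ultimately show ?thesis
    using prod_one_minus_primitive_root_powers[OF assms(1), of z "n - 1"] assms
    by (simp add: qpoch_def)
qed

text \<open>For \<open>g(x) = qsum z (n - 1) (x / z)\<close>, the terminating sums give \<open>g\<close> at every \<open>n\<close>-th
  root of unity, and there \<open>g(1/w) = g(w)/w\<close> except at \<open>w = z\<close> and \<open>w = 1/z\<close>. Pairing \<open>w\<close> with
  \<open>1/w\<close> in the interpolation formula for \<open>g'(1)\<close> then evaluates it.\<close>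

lemma qpoch_quot_sum_primitive_root:
  assumes z: "z \<in> primitive_roots n" and n: "odd n" "n > 1"
  defines "N \<equiv> (n + 1) div 2"
  shows "(\<Sum>k\<le>n - 1. qpoch_quot 1 (inverse z) (z ^ 2) k / qpoch z z k * z ^ k) =
    of_nat N * ((- 1) ^ N * inverse z ^ N\<^sup>2) + (1 + z) / (1 - z)"
proof -
  let ?U = "{w :: complex. w ^ n = 1}"
  \<comment> \<open>This realises the function \<open>g\<close> as a polynomial of degree below
    \<open>n\<close>, whose derivative at 1 is the sum to be found.\<close>
  define G where "G = (\<Sum>k\<le>n - 1. smult (z ^ k / qpoch z z k) (qpoch_poly (inverse z) (z ^ 2) k))"
  have n0: "n > 0" using n by simp
  have fin: "finite ?U" using n0 by (intro finite_roots_unity) auto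
  have N2: "2 * N = n + 1" using n by (auto simp: N_def)
  have zn: "z ^ n = 1" and zU: "z \<in> ?U" "inverse z \<in> ?U"
    using z by (auto simp: primitive_roots_def power_inverse)
  have z0: "z \<noteq> 0" using z n0 by (rule primitive_root_nonzero)
  have ne: "z ^ j \<noteq> 1" if "0 < j" "j < n" for j
    using that primitive_root_power_eq_1_iff[OF z n0, of j] by (auto dest: dvd_imp_le)
  have ne': "\<And>j. 0 < j \<Longrightarrow> j \<le> n - 1 \<Longrightarrow> z ^ j \<noteq> 1" using ne n0 by simp
  have z1: "z \<noteq> 1" using ne[of 1] n by simp
  have zi: "z \<noteq> inverse z"
  proof -
    have "n \<noteq> 2" using n by auto
    then have "z ^ 2 \<noteq> 1" using ne[of 2] n by simp
    then show ?thesis using z0 by (auto simp: power2_eq_square field_simps)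
  qed
  have G: "poly G x = qsum z (n - 1) (x * inverse z)" for x
    by (simp add: G_def qsum_def poly_sum poly_qpoch_poly mult.commute)
  have dG: "degree G < n"
  proof -
    have "degree G \<le> n - 1"
      unfolding G_def
      by (intro degree_sum_le order.trans[OF degree_smult_le] order.trans[OF degree_qpoch_poly_le]) auto
    then show ?thesis using n by simp
  qed
  have dG1: "poly (pderiv G) 1 = (\<Sum>k\<le>n - 1. qpoch_quot 1 (inverse z) (z ^ 2) k / qpoch z z k * z ^ k)"
    by (simp add: G_def higher_pderiv_sum[of 1, simplified] pderiv_smult poly_sum
        poly_pderiv_qpoch_poly mult.commute)
  \<comment> \<open>At these points the parameter \<open>x/z\<close> is \<open>z^(-2M)\<close>,
    where the sum terminates.\<close>
  have GM: "poly G (z * inverse z ^ (2 * M)) = (- 1) ^ M * inverse z ^ M\<^sup>2" if "M < n" for M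
  proof -
    have eq: "z * inverse z ^ (2 * M) * inverse z = inverse z ^ (2 * M)" using z0 by simp
    show ?thesis unfolding G eq using qsum_terminating[OF ne' z0, of "n - 1" M] that by simp
  qed
  \<comment> \<open>The point 1 has index \<open>N\<close>, since
    \<open>1 - 2N = -n\<close>.\<close>
  have G1: "poly G 1 = (- 1) ^ N * inverse z ^ N\<^sup>2"
    using GM[of N] N2 n z0 by (simp add: power_inverse zn)
  have Gz: "poly G z = 1" using GM[of 0] n by simp
  have Giz: "poly G (inverse z) = - inverse z"
    using GM[of 1] n z0 by (simp add: power2_eq_square field_simps)
  \<comment> \<open>As \<open>n\<close> is odd, \<open>z^(-2)\<close> is primitive too, so every
    root of unity is \<open>z z^(-2M)\<close> with \<open>M < n\<close>. Inversion sends
    \<open>M\<close> to \<open>n + 1 - M\<close>, which stays below \<open>n\<close> once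
    \<open>M = 0\<close> (\<open>w = z\<close>) and \<open>M = 1\<close> (\<open>w = 1/z\<close>)
    are excluded.\<close>
  have sym: "poly G (inverse w) = inverse w * poly G w" if w: "w \<in> ?U" "w \<noteq> z" "w \<noteq> inverse z" for w
  proof -
    have cop: "coprime 2 n" using n by simp
    have "w * inverse z \<in> ?U" using w zU by (simp add: power_mult_distrib)
    then obtain M where M: "M < n" "w * inverse z = (inverse z ^ 2) ^ M"
      using bij_betw_primitive_root_powers[OF primitive_root_power[OF primitive_root_inverse[OF z] n0 cop] n0]
      unfolding bij_betw_def by (metis (no_types, lifting) imageE lessThan_iff)
    have wM: "w = z * inverse z ^ (2 * M)"
      using M z0 unfolding power_mult by (simp add: field_simps)
    have "M \<noteq> 0" using wM w(2) by (intro notI) simp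
    moreover have "M \<noteq> 1" using wM w(3) z0 by (intro notI) (simp add: power2_eq_square)
    ultimately obtain a where a: "M = Suc a" "0 < a" by (cases M) auto
    have an: "a < n" "a \<le> n" using M a by auto
    have "z ^ (2 * a) * z ^ (2 * (n - a)) = (z ^ n) ^ 2"
      using an unfolding power_add[symmetric] power_mult[symmetric] distrib_left[symmetric]
      by (simp add: mult.commute)
    then have e: "inverse z ^ (2 * (n - a)) = z ^ (2 * a)"
      using z0 zn by (simp add: field_simps)
    have iw: "inverse w = z * inverse z ^ (2 * (n - a))"
      unfolding e using z0 by (simp add: wM a power_inverse)
    \<comment> \<open>The congruence of \<open>(n - a)^2\<close> and \<open>a^2\<close> modulo
      \<open>n\<close>, arranged without further subtraction of naturals.\<close>
    have "(n - a)\<^sup>2 + n * (2 * a) = n * n + a\<^sup>2"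
    proof -
      obtain b where "n = a + b" using an le_Suc_ex by blast
      then show ?thesis by (simp add: power2_eq_square algebra_simps)
    qed
    then have "inverse z ^ (n - a)\<^sup>2 * (inverse z ^ n) ^ (2 * a) = (inverse z ^ n) ^ n * inverse z ^ a\<^sup>2"
      by (metis power_add power_mult)
    then have sq: "inverse z ^ (n - a)\<^sup>2 = inverse z ^ a\<^sup>2"
      by (simp add: power_inverse zn)
    have "(- 1 :: complex) ^ (n - a) * (- 1) ^ a = - 1"
      using n an by (simp add: power_add[symmetric])
    then have sg: "(- 1 :: complex) ^ (n - a) = - ((- 1) ^ a)"
      by (cases "even a") auto
    have "poly G (inverse w) = - ((- 1) ^ a) * inverse z ^ a\<^sup>2"
      unfolding iw using GM[of "n - a"] a an by (simp add: sq sg)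
    also have "\<dots> = inverse w * poly G w"
    proof -
      have "inverse w = z ^ (2 * a + 1)" using z0 by (simp add: wM a power_inverse)
      then have c: "inverse w * inverse z ^ (2 * a + 1) = 1"
        using z0 by (metis left_inverse power_inverse power_not_zero right_inverse)
      have M2: "M\<^sup>2 = a\<^sup>2 + (2 * a + 1)" by (simp add: a power2_eq_square)
      have "inverse w * poly G w = (- 1) ^ M * inverse z ^ a\<^sup>2 * (inverse w * inverse z ^ (2 * a + 1))"
        using GM[OF M(1)] unfolding wM[symmetric] M2 power_add by (simp only: mult_ac)
      then show ?thesis unfolding c by (simp add: a)
    qed
    finally show ?thesis .
  qed
  let ?f = "\<lambda>w. poly G w * (w / (1 - w))"
  \<comment> \<open>For ordinary \<open>w\<close> the symmetry turns the left side into
    \<open>g(w)(w - 1/w)/(1 - w) = -g(w)(1 + 1/w)\<close>. At \<open>z\<close> and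
    \<open>1/z\<close> the symmetry fails by a sign, which costs \<open>2/(1 - z)\<close>.\<close>
  have pair: "?f w + ?f (inverse w) =
      - poly G w - poly G (inverse w) + (if w \<in> {z, inverse z} then 2 / (1 - z) else 0)"
    if w: "w \<in> ?U - {1}" for w
  proof -
    have at_z: "?f z + ?f (inverse z) = - poly G z - poly G (inverse z) + 2 / (1 - z)"
    proof -
      have "z + inverse z = (- 1 - - inverse z) * (1 - z) + 2" using z0 by (simp add: algebra_simps)
      then have "(z + inverse z) / (1 - z) = ((- 1 - - inverse z) * (1 - z) + 2) / (1 - z)"
        by (simp only:)
      also have "\<dots> = - 1 - - inverse z + 2 / (1 - z)"
        using z1 by (simp only: add_divide_distrib) simp
      finally have "z / (1 - z) + inverse z * (1 / (1 - z)) = - 1 - - inverse z + 2 / (1 - z)"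
        by (simp only: add_divide_distrib times_divide_eq_right mult_1_right)
      then show ?thesis
        unfolding Gz Giz inverse_over_one_minus_inverse[OF z0] mult_1_left minus_mult_minus .
    qed
    show ?thesis
    proof (cases "w \<in> {z, inverse z}")
      case True
      have "?f (inverse z) + ?f z = - poly G (inverse z) - poly G z + 2 / (1 - z)"
        by (subst add.commute, subst at_z) simp
      then have "?f w + ?f (inverse w) = - poly G w - poly G (inverse w) + 2 / (1 - z)"
        using True at_z by (metis insert_iff empty_iff inverse_inverse_eq)
      then show ?thesis using True by (simp only: if_True)
    next
      case False
      have w0: "w \<noteq> 0" and w1: "w \<noteq> 1" using w n0 by (auto simp: zero_power)
      have "w - inverse w = (- 1 - inverse w) * (1 - w)" using w0 by (simp add: algebra_simps)
      then have *: "w / (1 - w) - inverse w * (1 / (1 - w)) = - 1 - inverse w"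
        using w1 by (simp add: diff_divide_distrib[symmetric] nonzero_divide_eq_eq)
      have Gi: "poly G (inverse w) = inverse w * poly G w" using w False by (intro sym) auto
      have "?f w + ?f (inverse w) = poly G w * (w / (1 - w) - inverse w * (1 / (1 - w)))"
        unfolding inverse_over_one_minus_inverse[OF w0] Gi by (simp add: right_diff_distrib)
      also have "\<dots> = - poly G w - poly G (inverse w)"
        unfolding * Gi by (simp add: right_diff_distrib)
      finally show ?thesis using False by (simp only: if_False add_0_right)
    qed
  qed
  let ?S = "\<Sum>w\<in>?U - {1}. ?f w"
  let ?T = "\<Sum>w\<in>?U - {1}. poly G w"
  have "?S + ?S = (\<Sum>w\<in>?U - {1}. ?f w + ?f (inverse w))"
    using sum_inverse_roots_unity[where n = n and f = ?f] by (simp add: sum.distrib)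
  also have "\<dots> = (\<Sum>w\<in>?U - {1}. - poly G w - poly G (inverse w)
      + (if w \<in> {z, inverse z} then 2 / (1 - z) else 0))"
    by (intro sum.cong refl) (rule pair)
  also have "\<dots> = - ?T - ?T + (\<Sum>w\<in>?U - {1}. if w \<in> {z, inverse z} then 2 / (1 - z) else 0)"
    by (simp only: sum.distrib sum_subtractf sum_negf sum_inverse_roots_unity[where n = n and f = "poly G"])
  also have "(\<Sum>w\<in>?U - {1}. if w \<in> {z, inverse z} then 2 / (1 - z) else 0) =
      (\<Sum>w\<in>{z, inverse z}. 2 / (1 - z))"
    by (rule sum.mono_neutral_cong_right) (use fin zU z1 in auto)
  \<comment> \<open>Both exceptional points count: \<open>z\<close> and \<open>1/z\<close> differ
    because the order \<open>n\<close> is not 1 or 2.\<close>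
  also have "\<dots> = 4 / (1 - z)" using zi by simp
  finally have SS: "2 * ?S = - 2 * ?T + 4 / (1 - z)" by simp
  \<comment> \<open>The sum is \<open>n g(0)\<close>, where \<open>g(0)\<close> is the reciprocal of
    \<open>(z;z)_(n-1) = n\<close>.\<close>
  have "(\<Sum>w\<in>?U. poly G w) = 1"
    using sum_poly_roots_unity[OF z dG] qsum_0[OF ne'] qpoch_primitive_root[OF z n0] n0 by (simp add: G)
  then have T: "?T = 1 - poly G 1"
    using sum.remove[OF fin, of 1 "poly G"] by (simp add: eq_diff_eq add.commute)
  have nN: "(of_nat n - 1) / 2 = of_nat N - (1 :: complex)"
    using arg_cong[OF N2, of "of_nat :: nat \<Rightarrow> complex"] by (simp add: mult.commute)
  have "4 / (1 - z) = 2 * (2 / (1 - z))" by simp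
  then have "2 * (poly (pderiv G) 1 - (of_nat N - 1) * poly G 1) =
      2 * (- (1 - poly G 1) + 2 / (1 - z))"
    using SS unfolding T pderiv_at_1_via_roots_unity[OF z dG] nN by (simp only: distrib_left) simp
  then have "poly (pderiv G) 1 - (of_nat N - 1) * poly G 1 = - (1 - poly G 1) + 2 / (1 - z)"
    by (simp only: mult_cancel_left) simp
  then have "poly (pderiv G) 1 = - (1 - poly G 1) + 2 / (1 - z) + (of_nat N - 1) * poly G 1"
    by (simp only: diff_eq_eq)
  also have "\<dots> = of_nat N * poly G 1 + (2 / (1 - z) - 1)"
    by (simp add: left_diff_distrib)
  also have "2 / (1 - z) - 1 = (1 + z) / (1 - z)"
    using z1 by (simp add: divide_diff_eq_iff)
  finally show ?thesis unfolding dG1 G1 .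
qed

section \<open>Values of rational functions at complex points\<close>

text \<open>A relation instead of a function: regularity at \<open>z\<close> becomes part of the
  claim, witnessed by one suitable representation that need not be reduced.\<close>

definition has_value :: "rat poly fract \<Rightarrow> complex \<Rightarrow> complex \<Rightarrow> bool" where
  "has_value A z c \<longleftrightarrow> (\<exists>P Q. poly (map_poly of_rat Q) z \<noteq> 0 \<and> A = Fract P Q \<and>
     c = poly (map_poly of_rat P) z / poly (map_poly of_rat Q) z)"

lemma map_poly_of_rat_uminus: "map_poly of_rat (- p) = (- map_poly of_rat p :: complex poly)"
  by (rule poly_eqI) (simp add: coeff_map_poly of_rat_minus)

lemma has_valueI:
  "poly (map_poly of_rat Q) z \<noteq> 0 \<Longrightarrow> A = Fract P Q \<Longrightarrow>
    c = poly (map_poly of_rat P) z / poly (map_poly of_rat Q) z \<Longrightarrow> has_value A z c"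
  unfolding has_value_def by blast

lemma has_value_0: "has_value 0 z 0"
  by (rule has_valueI[of 1 _ _ 0]) (simp_all add: Zero_fract_def)

lemma has_value_1: "has_value 1 z 1"
  by (rule has_valueI[of 1 _ _ 1]) (simp_all add: One_fract_def)

lemma has_value_qvar: "has_value qvar z z"
  by (rule has_valueI[of 1 _ _ "[:0, 1:]"]) (simp_all add: qvar_def map_poly_pCons)

lemma has_value_uminus: "has_value A z a \<Longrightarrow> has_value (- A) z (- a)"
  unfolding has_value_def by (metis minus_fract map_poly_of_rat_uminus poly_minus minus_divide_left)

lemma has_value_add:
  assumes "has_value A z a" "has_value B z b"
  shows "has_value (A + B) z (a + b)"
proof -
  from assms obtain P Q P' Q' where
    "poly (map_poly of_rat Q) z \<noteq> 0" "A = Fract P Q"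
    "a = poly (map_poly of_rat P) z / poly (map_poly of_rat Q) z"
    "poly (map_poly of_rat Q') z \<noteq> 0" "B = Fract P' Q'"
    "b = poly (map_poly of_rat P') z / poly (map_poly of_rat Q') z"
    unfolding has_value_def by blast
  moreover from this have "Q \<noteq> 0" "Q' \<noteq> 0" by auto
  ultimately show ?thesis
    by (intro has_valueI[of "Q * Q'" _ _ "P * Q' + P' * Q"])
       (auto simp: map_poly_of_rat_mult map_poly_of_rat_add add_frac_eq)
qed

lemma has_value_mult:
  assumes "has_value A z a" "has_value B z b"
  shows "has_value (A * B) z (a * b)"
proof -
  from assms obtain P Q P' Q' where
    "poly (map_poly of_rat Q) z \<noteq> 0" "A = Fract P Q"
    "a = poly (map_poly of_rat P) z / poly (map_poly of_rat Q) z"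
    "poly (map_poly of_rat Q') z \<noteq> 0" "B = Fract P' Q'"
    "b = poly (map_poly of_rat P') z / poly (map_poly of_rat Q') z"
    unfolding has_value_def by blast
  then show ?thesis
    by (intro has_valueI[of "Q * Q'" _ _ "P * P'"]) (auto simp: map_poly_of_rat_mult)
qed

lemma has_value_inverse:
  assumes "has_value A z a" "a \<noteq> 0"
  shows "has_value (inverse A) z (inverse a)"
proof -
  from assms obtain P Q where
    "poly (map_poly of_rat Q) z \<noteq> 0" "A = Fract P Q"
    "a = poly (map_poly of_rat P) z / poly (map_poly of_rat Q) z"
    unfolding has_value_def by blast
  then show ?thesis using assms(2) by (intro has_valueI[of P _ _ Q]) auto
qed

lemma has_value_diff: "has_value A z a \<Longrightarrow> has_value B z b \<Longrightarrow> has_value (A - B) z (a - b)"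
  using has_value_add[OF _ has_value_uminus] by (metis diff_conv_add_uminus)

lemma has_value_divide:
  "has_value A z a \<Longrightarrow> has_value B z b \<Longrightarrow> b \<noteq> 0 \<Longrightarrow> has_value (A / B) z (a / b)"
  by (simp add: divide_inverse has_value_mult has_value_inverse)

lemma has_value_power: "has_value A z a \<Longrightarrow> has_value (A ^ k) z (a ^ k)"
  by (induction k) (auto intro: has_value_1 has_value_mult)

lemma has_value_sum:
  "(\<And>i. i \<in> I \<Longrightarrow> has_value (f i) z (g i)) \<Longrightarrow> has_value (sum f I) z (sum g I)"
  by (induction I rule: infinite_finite_induct) (auto intro: has_value_0 has_value_add)

lemma has_value_prod:
  "(\<And>i. i \<in> I \<Longrightarrow> has_value (f i) z (g i)) \<Longrightarrow> has_value (prod f I) z (prod g I)"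
  by (induction I rule: infinite_finite_induct) (auto intro: has_value_1 has_value_mult)

lemmas has_value_intros = has_value_1 has_value_qvar has_value_uminus has_value_add has_value_mult
  has_value_diff has_value_divide has_value_power has_value_sum has_value_prod has_value_inverse

lemma has_value_qpoch: "has_value A z a \<Longrightarrow> has_value B z b \<Longrightarrow> has_value (qpoch A B k) z (qpoch a b k)"
  unfolding qpoch_def by (intro has_value_intros)

lemma has_value_qint: "has_value A z a \<Longrightarrow> has_value (qint A k) z (qint a k)"
  unfolding qint_def by (intro has_value_intros)

lemma has_value_qpoch_quot:
  "has_value Y z y \<Longrightarrow> has_value A z a \<Longrightarrow> has_value B z b \<Longrightarrow>
    has_value (qpoch_quot Y A B k) z (qpoch_quot y a b k)"
  by (induction k) (auto intro!: has_value_intros has_value_qpoch has_value_0)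

text \<open>Cross-multiplication with the witnessing fraction. The form without division also covers
  a \<open>Q\<close> that vanishes at \<open>z\<close>, where it forces \<open>P\<close> to vanish
  as well.\<close>

lemma has_value_unique:
  assumes "has_value A z a" "A = Fract P Q" "Q \<noteq> 0"
  shows "poly (map_poly of_rat P) z = a * poly (map_poly of_rat Q) z"
proof -
  from assms(1) obtain P' Q' where *:
    "poly (map_poly of_rat Q') z \<noteq> 0" "A = Fract P' Q'"
    "a = poly (map_poly of_rat P') z / poly (map_poly of_rat Q') z"
    unfolding has_value_def by blast
  then have "Q' \<noteq> 0" by auto
  then have "P * Q' = P' * Q" using * assms by (simp add: eq_fract)
  then have "poly (map_poly of_rat (P * Q')) z = poly (map_poly of_rat (P' * Q)) z" by simp
  then have "poly (map_poly of_rat P) z * poly (map_poly of_rat Q') z =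
      a * poly (map_poly of_rat Q) z * poly (map_poly of_rat Q') z"
    using * by (simp add: map_poly_of_rat_mult)
  then show ?thesis using *(1) by simp
qed

lemma qvar_nonzero: "qvar \<noteq> 0"
  by (simp add: qvar_def Zero_fract_def eq_fract)

lemma qvar_power_neq_1:
  assumes "k > 0"
  shows "qvar ^ k \<noteq> 1"
proof
  assume "qvar ^ k = 1"
  \<comment> \<open>Evaluation at the point 2 refutes the equation, since \<open>2^k\<close> exceeds
    1.\<close>
  then have "has_value (Fract 1 1) 2 (2 ^ k)"
    using has_value_power[OF has_value_qvar, of k 2] by (simp add: One_fract_def)
  from has_value_unique[OF this refl] have "(2 :: complex) ^ k = 1" by simp
  then have "norm ((2 :: complex) ^ k) = 1" by simp
  then have "(2 :: real) ^ k = 1" by (simp add: norm_power)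
  then show False using one_less_power[of "2 :: real" k] assms by simp
qed

section \<open>Divisibility by the cyclotomic polynomial, tested at primitive roots\<close>

lemma poly_cyclotomic_eq_0_iff:
  assumes "n > 0"
  shows "poly (map_poly of_rat (cyclotomic n)) z = 0 \<longleftrightarrow> z \<in> primitive_roots n"
  using assms by (auto simp: of_rat_cyclotomic poly_prod finite_primitive_roots)

text \<open>A nonzero remainder would vanish at all primitive roots, whose number is the degree of
  the divisor because its roots are simple.\<close>

lemma cyclotomic_dvdI:
  assumes n: "n > 0" and roots: "\<And>z. z \<in> primitive_roots n \<Longrightarrow> poly (map_poly of_rat P) z = 0"
  shows "cyclotomic n dvd P"
proof (rule ccontr)
  let ?R = "P mod cyclotomic n"
  assume "\<not> cyclotomic n dvd P"
  then have R: "?R \<noteq> 0" by (simp add: dvd_eq_mod_eq_0)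
  have C: "map_poly of_rat (cyclotomic n) \<noteq> (0 :: complex poly)"
    using n by (simp add: of_rat_cyclotomic finite_primitive_roots)
  then have "cyclotomic n \<noteq> 0" by auto
  then have deg: "degree ?R < degree (cyclotomic n)"
    using degree_mod_less[of "cyclotomic n" P] R by auto
  have "degree (cyclotomic n) = card (primitive_roots n)"
    by (simp add: degree_map_poly_of_rat[symmetric] of_rat_cyclotomic[OF n] degree_prod_eq_sum_degree)
  also have "\<dots> \<le> card {z. poly (map_poly of_rat ?R) z = (0 :: complex)}"
  proof (rule card_mono)
    show "finite {z. poly (map_poly of_rat ?R) z = (0 :: complex)}"
      using R by (intro poly_roots_finite) (metis map_poly_of_rat_inj map_poly_0)
    have "map_poly of_rat P = (map_poly of_rat (P div cyclotomic n) * map_poly of_rat (cyclotomic n)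
        + map_poly of_rat ?R :: complex poly)"
      by (metis div_mult_mod_eq map_poly_of_rat_add map_poly_of_rat_mult)
    then have "poly (map_poly of_rat ?R) z = 0" if "z \<in> primitive_roots n" for z
      using roots[OF that] poly_cyclotomic_eq_0_iff[OF n, of z] that by simp
    then show "primitive_roots n \<subseteq> {z. poly (map_poly of_rat ?R) z = 0}" by auto
  qed
  also have "\<dots> \<le> degree ?R"
    using card_poly_roots_bound[of "map_poly of_rat ?R :: complex poly"] R
    by (metis degree_map_poly_of_rat map_poly_of_rat_inj map_poly_0)
  finally show False using deg by simp
qed

text \<open>A nonconstant common divisor would have a complex root, and that root would be a
  primitive root of unity annihilating \<open>Q\<close>.\<close>

lemma coprime_cyclotomicI:
  assumes n: "n > 0" and roots: "\<And>z. z \<in> primitive_roots n \<Longrightarrow> poly (map_poly of_rat Q) z \<noteq> 0"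
  shows "coprime Q (cyclotomic n)"
proof (rule coprimeI)
  fix d assume d: "d dvd Q" "d dvd cyclotomic n"
  have ev: "poly (map_poly of_rat p) z = 0" if "d dvd p" "poly (map_poly of_rat d) z = 0" for p and z :: complex
    using that by (auto simp: map_poly_of_rat_mult elim!: dvdE)
  show "is_unit d"
  proof (rule ccontr)
    assume nu: "\<not> is_unit d"
    have "d \<noteq> 0"
    proof
      assume "d = 0"
      then have "cyclotomic n = 0" using d by simp
      then show False using of_rat_cyclotomic[OF n] n by (simp add: finite_primitive_roots)
    qed
    then have "degree d \<noteq> 0" using nu by (simp add: is_unit_iff_degree)
    then have "degree (map_poly of_rat d :: complex poly) \<noteq> 0" by (simp add: degree_map_poly_of_rat)
    then obtain z :: complex where z: "poly (map_poly of_rat d) z = 0"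
      using fundamental_theorem_of_algebra[of "map_poly of_rat d"] by (auto simp: constant_degree)
    then show False using ev[OF d(1) z] ev[OF d(2) z] roots poly_cyclotomic_eq_0_iff[OF n] by blast
  qed
qed

text \<open>One cyclotomic factor comes from \<open>1 - q^n\<close>, the other from the numerator of
  \<open>W\<close> in lowest terms. Lowest terms also keep the denominator nonzero at the primitive
  roots.\<close>

lemma cong_cyclotomic_sqI:
  assumes n: "n > 0" and eq: "A - B = (1 - qvar ^ n) * W"
    and W: "\<And>z. z \<in> primitive_roots n \<Longrightarrow> has_value W z 0"
  shows "cong_cyclotomic_sq n A B"
proof -
  define P Q where "P = fst (quot_of_fract W)" and "Q = snd (quot_of_fract W)"
  have PQ: "W = Fract P Q" "Q \<noteq> 0" "coprime P Q"
    by (simp_all add: P_def Q_def coprime_quot_of_fract)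
  have P0: "poly (map_poly of_rat P) z = 0" if "z \<in> primitive_roots n" for z
    using has_value_unique[OF W[OF that] PQ(1,2)] by simp
  have Q0: "poly (map_poly of_rat Q) z \<noteq> 0" if "z \<in> primitive_roots n" for z
  proof
    assume Qz: "poly (map_poly of_rat Q) z = 0"
    \<comment> \<open>A Bezout identity over the rationals, evaluated at \<open>z\<close>, excludes
      a common zero.\<close>
    obtain a b where "a * P + b * Q = 1"
      using PQ(3) by (metis coprime_iff_gcd_eq_1 bezout_coefficients_fst_snd)
    then have "poly (map_poly of_rat (a * P + b * Q)) z = 1" by simp
    then show False using P0[OF that] Qz by (simp add: map_poly_of_rat_mult map_poly_of_rat_add)
  qed
  have "map_poly of_rat (1 - monom 1 n) = (1 - monom 1 n :: complex poly)"
    by (rule poly_eqI) (auto simp: coeff_map_poly coeff_1)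
  then have "cyclotomic n dvd 1 - monom 1 n"
    by (intro cyclotomic_dvdI[OF n]) (auto simp: poly_monom primitive_roots_def)
  moreover have "cyclotomic n dvd P" by (rule cyclotomic_dvdI[OF n P0])
  ultimately have dvd: "cyclotomic n ^ 2 dvd (1 - monom 1 n) * P"
    by (simp add: power2_eq_square mult_dvd_mono)
  have "qvar ^ n = Fract (monom 1 n) 1"
    by (induction n) (simp_all add: qvar_def One_fract_def monom_Suc)
  then have "A - B = Fract ((1 - monom 1 n) * P) Q"
    by (simp add: eq PQ(1) One_fract_def)
  then show ?thesis
    unfolding cong_cyclotomic_sq_def using PQ(2) dvd coprime_cyclotomicI[OF n Q0] by blast
qed

section \<open>Both congruences, by exhibiting the cofactors of \<open>1 - q^n\<close>\<close>

theorem theorem1p1: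
  fixes n :: nat
  assumes "odd n" and "n > 1"
  shows "cong_cyclotomic_sq n
           (\<Sum>k = 0..n - 1. qpoch (inverse qvar) (qvar ^ 2) k / qpoch qvar qvar k * qvar ^ k)
           ((- 1) ^ ((n + 1) div 2) * qvar ^ ((n ^ 2 - 1) div 4) - (1 + qvar) * qint qvar n) \<and>
         cong_cyclotomic_sq n
           (\<Sum>k = 0..n - 1. qpoch (inverse qvar) (qvar ^ 2) k / qpoch qvar qvar k * qvar ^ (2 * k))
           ((- 1) ^ ((n + 1) div 2) * qvar ^ ((n ^ 2 + 3) div 4) - 2 * qvar * qint qvar n)"
proof -
  define q where "q = qvar"
  define m where "m = n div 2"
  define N where "N = m + 1"
  define y where "y = inverse q ^ n"
  define e :: "rat poly fract" where "e = (- 1) ^ N"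
  define D where "D = (\<Sum>k\<le>n - 1. qpoch_quot y (inverse q) (q ^ 2) k / qpoch q q k * q ^ k)"
  \<comment> \<open>\<open>W\<close> is the cofactor of \<open>1 - q^n\<close> in the error of the
    first congruence. \<open>V\<close> is the boundary term of the telescoped sum with its factor
    \<open>1 - q^n\<close>, at index \<open>N\<close>, removed.\<close>
  define W where "W = (1 + q) / (1 - q) + e * inverse q ^ N\<^sup>2 * qint (q ^ n) N - y * D"
  define V where "V = (\<Prod>i\<in>{..<n} - {N}. 1 - inverse q * (q ^ 2) ^ i) / qpoch q q (n - 1)"
  let ?S1 = "\<Sum>k = 0..n - 1. qpoch (inverse q) (q ^ 2) k / qpoch q q k * q ^ k"
  let ?S2 = "\<Sum>k = 0..n - 1. qpoch (inverse q) (q ^ 2) k / qpoch q q k * q ^ (2 * k)"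
  have n: "n = 2 * m + 1" "m > 0" and n0: "n > 0" and N': "(n + 1) div 2 = N"
    using assms by (auto simp: m_def N_def)
  have q0: "q \<noteq> 0" and q1: "\<And>j. 0 < j \<Longrightarrow> q ^ j \<noteq> 1" and q1': "1 - q \<noteq> 0"
    using qvar_nonzero qvar_power_neq_1 qvar_power_neq_1[of 1] by (auto simp: q_def)
  have S1: "?S1 = qsum q (n - 1) (inverse q)"
    by (simp add: qsum_def atLeast0AtMost)
  have yq: "y * q ^ n = 1" using q0 by (simp add: y_def power_inverse)
  have qN: "inverse q ^ N\<^sup>2 * (q ^ n) ^ N = q ^ (m * m + m)"
  proof -
    have "n * N = N\<^sup>2 + (m * m + m)" by (simp add: n N_def power2_eq_square algebra_simps)
    then show ?thesis using q0 by (simp add: power_mult[symmetric] power_add power_inverse)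
  qed

  have "?S1 - qsum q (n - 1) (y * inverse q) = (1 - y) * D"
    unfolding S1 qsum_def D_def sum_subtractf[symmetric] sum_distrib_left
    by (intro sum.cong refl)
       (simp add: diff_divide_distrib[symmetric] left_diff_distrib[symmetric] qpoch_diff)
  \<comment> \<open>Here \<open>n + 1 = 2N\<close>, so the perturbed parameter is a terminating one;
    \<open>N \<le> n - 1\<close> holds because \<open>m > 0\<close>.\<close>
  moreover have "y * inverse q = inverse q ^ (2 * N)"
    by (simp add: y_def n N_def)
  then have "qsum q (n - 1) (y * inverse q) = e * inverse q ^ N\<^sup>2"
    unfolding e_def using n q1 q0 by (simp only:) (rule qsum_terminating, auto simp: N_def)
  moreover have "1 - y = (1 - q ^ n) * (- y)"
    using yq by (simp add: algebra_simps)
  ultimately have "?S1 = e * inverse q ^ N\<^sup>2 + (1 - q ^ n) * (- y) * D"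
    by (simp add: algebra_simps)
  \<comment> \<open>Since \<open>nN = N^2 + m^2 + m\<close>, the exponent \<open>-N^2\<close>
    becomes \<open>m^2 + m = (n^2 - 1)/4\<close> at the cost of a multiple of
    \<open>1 - q^(nN)\<close>, hence of \<open>1 - q^n\<close>.\<close>
  moreover have "e * inverse q ^ N\<^sup>2 = e * q ^ (m * m + m) + e * inverse q ^ N\<^sup>2 * ((1 - q ^ n) * qint (q ^ n) N)"
    unfolding qint_mult qN[symmetric] by (simp add: algebra_simps)
  moreover have qi: "qint q n = (1 - q ^ n) / (1 - q)"
    using qint_mult[of q n] q1' by (simp add: field_simps)
  ultimately have T1: "?S1 - (e * q ^ (m * m + m) - (1 + q) * qint q n) = (1 - q ^ n) * W"
    by (simp add: W_def algebra_simps)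

  have "qpoch (inverse q) (q ^ 2) n = (1 - inverse q * (q ^ 2) ^ N) *
      (\<Prod>i\<in>{..<n} - {N}. 1 - inverse q * (q ^ 2) ^ i)"
    unfolding qpoch_def using n by (intro prod.remove) (auto simp: N_def)
  moreover have "inverse q * (q ^ 2) ^ N = q ^ n"
    using q0 unfolding power_mult[symmetric] by (simp add: n N_def)
  ultimately have "qpoch (inverse q) (q ^ 2) n / qpoch q q (n - 1) = (1 - q ^ n) * V"
    by (simp add: V_def)
  then have "?S1 = inverse q * ?S2 + (1 - q ^ n) * V"
    unfolding S1 using qsum_square_weight[of "n - 1" q "inverse q"] q1 n0
    by (simp add: atLeast0AtMost)
  then have "?S2 = q * ?S1 - q * (1 - q ^ n) * V"
    using q0 by (simp add: field_simps)
  moreover have "?S1 = (e * q ^ (m * m + m) - (1 + q) * qint q n) + (1 - q ^ n) * W"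
    using T1 by (simp add: algebra_simps)
  ultimately have "?S2 = q * ((e * q ^ (m * m + m) - (1 + q) * qint q n) + (1 - q ^ n) * W)
      - q * (1 - q ^ n) * V" by simp
  \<comment> \<open>Having \<open>2q\<close> in place of \<open>q(1 + q)\<close> before
    \<open>[n]\<close> leaves \<open>q(1 - q)[n] = q(1 - q^n)\<close>, the source of the 1 in
    \<open>1 - V\<close> below.\<close>
  then have "?S2 - (e * q ^ (m * m + m + 1) - 2 * q * qint q n) =
      (1 - q ^ n) * (q * W - q * V) + q * ((1 - q) * qint q n)"
    by (simp add: algebra_simps)
  then have T2: "?S2 - (e * q ^ (m * m + m + 1) - 2 * q * qint q n)
      = (1 - q ^ n) * (q * W + q * (1 - V))"
    unfolding qint_mult by (simp add: algebra_simps)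

  \<comment> \<open>At \<open>z\<close> both \<open>y\<close> and \<open>q^n\<close> become 1 and
    \<open>qint (q ^ n) N\<close> becomes \<open>N\<close>, so the value of \<open>D\<close> cancels
    the other two terms of \<open>W\<close>; in \<open>V\<close> the numerator and the denominator
    both become \<open>n\<close>.\<close>
  have vals: "has_value W z 0" "has_value V z 1" if z: "z \<in> primitive_roots n" for z
  proof -
    have z0: "z \<noteq> 0" using z n0 by (rule primitive_root_nonzero)
    have zn: "z ^ n = 1" using z by (simp add: primitive_roots_def)
    have ne: "\<And>j. 0 < j \<Longrightarrow> j \<le> n - 1 \<Longrightarrow> z ^ j \<noteq> 1"
      using z by (auto simp: primitive_roots_def)
    have z1: "1 - z \<noteq> 0" using ne[of 1] assms by auto
    have q: "has_value q z z" by (simp add: q_def has_value_qvar)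
    have y: "has_value y z 1"
      using has_value_power[OF has_value_inverse[OF q z0], of n] by (simp add: y_def power_inverse zn)
    have qp: "qpoch z z k \<noteq> 0" if "k \<le> n - 1" for k
      using that ne by (intro qpoch_self_nonzero) auto
    have "has_value D z (\<Sum>k\<le>n - 1. qpoch_quot 1 (inverse z) (z ^ 2) k / qpoch z z k * z ^ k)"
      unfolding D_def using q y z0 qp
      by (intro has_value_intros has_value_qpoch has_value_qpoch_quot) auto
    then have D: "has_value D z (of_nat N * ((- 1) ^ N * inverse z ^ N\<^sup>2) + (1 + z) / (1 - z))"
      unfolding qpoch_quot_sum_primitive_root[OF z assms] N' .
    have "has_value W z ((1 + z) / (1 - z) + (- 1) ^ N * inverse z ^ N\<^sup>2 * qint (z ^ n) N
        - 1 * (of_nat N * ((- 1) ^ N * inverse z ^ N\<^sup>2) + (1 + z) / (1 - z)))"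
      unfolding W_def e_def using q y z0 z1 D
      by (intro has_value_intros has_value_qint) auto
    then show "has_value W z 0" by (simp add: zn qint_def mult.commute)
    have "has_value V z ((\<Prod>i\<in>{..<n} - {N}. 1 - inverse z * (z ^ 2) ^ i) / qpoch z z (n - 1))"
      unfolding V_def using q z0 qp by (intro has_value_intros has_value_qpoch) auto
    moreover have "(\<Prod>i\<in>{..<n} - {N}. 1 - inverse z * (z ^ 2) ^ i) = of_nat n"
    proof (rule prod_one_minus_primitive_root_powers)
      \<comment> \<open>Oddness of \<open>n\<close> keeps \<open>z^2\<close> primitive.\<close>
      show "z ^ 2 \<in> primitive_roots n"
        using primitive_root_power[OF z n0, of 2] assms by simp
      have "inverse z * (z ^ 2) ^ N = z ^ n"
        using z0 unfolding power_mult[symmetric] by (simp add: n N_def)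
      then show "inverse z * (z ^ 2) ^ N = 1" by (simp add: zn)
      show "inverse z ^ n = 1" by (simp add: power_inverse zn)
      show "N < n" using n by (simp add: N_def)
    qed
    ultimately show "has_value V z 1" using qpoch_primitive_root[OF z n0] n0 by simp
  qed
  have "has_value (q * W + q * (1 - V)) z 0" if "z \<in> primitive_roots n" for z
  proof -
    have "has_value (q * W + q * (1 - V)) z (z * 0 + z * (1 - 1))"
      unfolding q_def by (intro has_value_intros vals[OF that])
    then show ?thesis by simp
  qed
  moreover have "(n\<^sup>2 - 1) div 4 = m * m + m" "(n\<^sup>2 + 3) div 4 = m * m + m + 1"
    by (simp_all add: n power2_eq_square algebra_simps)
  ultimately show ?thesis
    using cong_cyclotomic_sqI[OF n0 T1[unfolded q_def] vals(1)]
      cong_cyclotomic_sqI[OF n0 T2[unfolded q_def]]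
    unfolding N' by (simp add: e_def q_def)
qed

end
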